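(* For any tree $T$ with $n$ vertices, $$P(T)\le P(S_n)\quad\text{and}\quad Q(T)\le Q(S_n),$$ where $S_n$ is the star graph with $n$ vertices.
   Context: The misère tree search game $MS(T)$ is played by two players on a finite tree $T$. One vertex of $T$, chosen uniformly at random and unknown to both players, is poisoned. The players alternately guess a vertex of the current tree. If a player guesses the poisoned vertex, that player loses (and the other wins). Otherwise the guessed vertex is deleted from the current tree, it is revealed which of the resulting connected components contains the poisoned vertex, and the game continues on that component with the other player to move. (A player facing a one-vertex tree must guess it and loses.) One player, $R$, makes every guess uniformly at random among the vertices of the current tree. The other player, $X$, knows this and plays so as to maximise the probability of winning against $R$. $P(T)$ and $Q(T)$ denote the probability that $X$ wins $MS(T)$ against $R$ when $X$ is the first player and the second player respectively. The star $S_n$ is the tree with one root vertex and $n-1$ leaves, each adjacent to the root. *)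

theory Defs
  imports "HOL-Probability.Probability_Mass_Function" "Graph_Theory.Graph_Theory"
begin

text \<open>
  Graphs are the finite simple graphs of \<open>Graph_Theory\<close>, i.e. symmetric digraphs (locale
  \<open>graph\<close>), in which an undirected edge is a pair of opposite arcs.  The library's own
  \<open>tree\<close> forbids all directed cycles, hence also the cycles of length two formed by opposite arcs,
  so it is not the notion for symmetric digraphs; there, the cycles of the underlying
  undirected graph are those of length at least three.
\<close>

definition is_tree :: "('a, 'b) pre_digraph \<Rightarrow> bool" where
  "is_tree T \<longleftrightarrow> graph T \<and> Digraph_Component.connected T \<and>
     \<not> (\<exists>c. pre_digraph.cycle T c \<and> 3 \<le> length c)"

definition star :: "nat \<Rightarrow> (nat, nat \<times> nat) pre_digraph" where
  "star n = with_proj \<lparr>pverts = {0..<n}, parcs = {0} \<times> {1..<n} \<union> {1..<n} \<times> {0}\<rparr>"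

text \<open>
  The component of the graph minus \<open>v\<close> that contains the poisoned vertex \<open>p\<close>.  In a symmetric
  digraph the strongly connected components are the connected components.
\<close>

definition surviving_tree :: "('a, 'b) pre_digraph \<Rightarrow> 'a \<Rightarrow> 'a \<Rightarrow> ('a, 'b) pre_digraph" where
  "surviving_tree T v p =
     (let H = pre_digraph.del_vert T v in H \<restriction> pre_digraph.scc_of H p)"

text \<open>
  A strategy may randomise and may use everything \<open>X\<close> has observed: all earlier guesses, each with
  the tree in which it was made (most recent first), and the current tree.
\<close>

type_synonym ('a, 'b) history = "(('a, 'b) pre_digraph \<times> 'a) list"
type_synonym ('a, 'b) strategy = "('a, 'b) history \<Rightarrow> ('a, 'b) pre_digraph \<Rightarrow> 'a pmf"

definition strategies :: "('a, 'b) strategy set" where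
  "strategies = {\<sigma>. \<forall>h T. verts T \<noteq> {} \<longrightarrow> set_pmf (\<sigma> h T) \<subseteq> verts T}"

text \<open>
  The distribution of the event that \<open>X\<close> wins, for a fixed poisoned vertex \<open>p\<close>; the flag \<open>x\<close> tells
  whether \<open>X\<close> is to move.  The conditions on \<open>verts T\<close> only secure termination: in a finite tree
  no player guesses outside the tree.
\<close>

function play ::
    "('a, 'b) strategy \<Rightarrow> 'a \<Rightarrow> bool \<Rightarrow> ('a, 'b) history \<Rightarrow> ('a, 'b) pre_digraph \<Rightarrow> bool pmf" where
  "play \<sigma> p x h T =
     bind_pmf (if x then \<sigma> h T else pmf_of_set (verts T)) (\<lambda>v.
       if v = p \<or> v \<notin> verts T \<or> infinite (verts T) then return_pmf (\<not> x)
       else play \<sigma> p (\<not> x) ((T, v) # h) (surviving_tree T v p))"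
  by pat_completeness auto

lemma verts_surviving_tree: "verts (surviving_tree T v p) \<subseteq> verts T - {v}"
proof
  fix u assume "u \<in> verts (surviving_tree T v p)"
  then have "u \<in> pre_digraph.scc_of (pre_digraph.del_vert T v) p"
    by (simp add: surviving_tree_def Let_def induce_subgraph_def)
  then have "(u, p) \<in> rtrancl_on (verts (pre_digraph.del_vert T v))
      (arcs_ends (pre_digraph.del_vert T v))"
    by (simp add: pre_digraph.scc_of_def reachable_def)
  then have "u \<in> verts (pre_digraph.del_vert T v)"
    by (induct rule: rtrancl_on.induct) auto
  then show "u \<in> verts T - {v}"
    by (simp add: pre_digraph.verts_del_vert)
qed

termination play
proof (relation "Wellfounded.measure (\<lambda>(_, _, _, _, T). card (verts T))", goal_cases)
  case 1
  then show ?case by simp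
next
  case (2 \<sigma> p x h T v)
  then have "finite (verts T)" "v \<in> verts T"
    by auto
  then have "card (verts (surviving_tree T v p)) < card (verts T)"
    using verts_surviving_tree[of T v p] by (intro psubset_card_mono) auto
  then show ?case by simp
qed

declare play.simps[simp del]

definition misere_game :: "('a, 'b) strategy \<Rightarrow> bool \<Rightarrow> ('a, 'b) pre_digraph \<Rightarrow> bool pmf" where
  "misere_game \<sigma> x T = bind_pmf (pmf_of_set (verts T)) (\<lambda>p. play \<sigma> p x [] T)"

definition misere_P :: "('a, 'b) pre_digraph \<Rightarrow> real" where
  "misere_P T = (SUP \<sigma>\<in>strategies. measure_pmf.prob (misere_game \<sigma> True T) {True})"

definition misere_Q :: "('a, 'b) pre_digraph \<Rightarrow> real" where
  "misere_Q T = (SUP \<sigma>\<in>strategies. measure_pmf.prob (misere_game \<sigma> False T) {True})"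

end

theory Submission
  imports Defs
begin

text \<open>
  Summing over the position of the poison gives short bounds. Whenever \<open>X\<close> is about to guess in a
  component with \<open>m\<close> vertices, the guess cannot depend on which of these vertices is poisoned, so
  on the sum over the \<open>m\<close> possible positions \<open>X\<close> loses at least total weight \<open>1\<close> at once
  (\<open>sum_mover_survival_le\<close>).

  If \<open>X\<close> moves first, this gives \<open>P(T) \<le> (n - 1)/n\<close>. If \<open>R\<close> moves first and guesses \<open>v\<close>, the bound
  applies to every component of \<open>T - v\<close>; with \<open>c(v)\<close> components, \<open>X\<close> wins weight at most
  \<open>1 + (n - 1) - c(v)\<close>, the leading \<open>1\<close> being the case in which \<open>R\<close> hits the poison. Hence
  \<open>n\<^sup>2 Q(T) \<le> n\<^sup>2 - (\<Sum>v. c(v))\<close>.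

  In a tree the neighbours of \<open>v\<close> lie in different components of \<open>T - v\<close>, as otherwise there would
  be a cycle through \<open>v\<close>. So \<open>c(v)\<close> is at least the degree of \<open>v\<close>, and the degrees sum to at least
  \<open>2(n - 1)\<close> because \<open>T\<close> is connected (\<open>tree_sum_branches_ge\<close>). This yields
  \<open>n\<^sup>2 Q(T) \<le> n\<^sup>2 - 2(n - 1) = n + (n - 1)(n - 2)\<close>.

  The star attains both bounds: \<open>X\<close> guesses the centre, unless it is already gone. If that guess is
  harmless, the poison is alone in its component and \<open>R\<close>, forced to take it, loses.
\<close>

section \<open>Counting the components left by vertex deletions\<close>

text \<open>
  Every connected graph on \<open>V\<close> has at least \<open>card V - 1\<close> edges: a vertex set grown one vertex at a
  time along edges leaving it gains an edge with each new vertex. An edge counts twice, since both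
  of its orientations belong to the symmetric relation.
\<close>

lemma double_spanning_edges_le_card:
  fixes E :: "('v \<times> 'v) set"
  assumes fin: "finite V" and ne: "V \<noteq> {}" and "sym E"
    and leave: "\<And>S. S \<subset> V \<Longrightarrow> S \<noteq> {} \<Longrightarrow> \<exists>x\<in>S. \<exists>y\<in>V - S. (x, y) \<in> E"
  shows "2 * (card V - 1) \<le> card (E \<inter> V \<times> V)"
proof -
  have grow: "\<exists>S\<subseteq>V. card S = Suc k \<and> 2 * k \<le> card (E \<inter> S \<times> S)" if "k < card V" for k
    using that
  proof (induction k)
    case 0
    from ne obtain x where "x \<in> V" by blast
    then show ?case by (intro exI[of _ "{x}"]) auto
  next
    case (Suc k)
    then obtain S where S: "S \<subseteq> V" "card S = Suc k" "2 * k \<le> card (E \<inter> S \<times> S)"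
      by auto
    have finS: "finite S" using S(1) fin by (rule finite_subset)
    have "S \<subset> V" "S \<noteq> {}" using S Suc.prems by auto
    then obtain x y where xy: "x \<in> S" "y \<in> V" "y \<notin> S" "(x, y) \<in> E"
      using leave[of S] by auto
    have yx: "(y, x) \<in> E" using xy(4) by (rule symD[OF \<open>sym E\<close>])
    have "x \<noteq> y" using xy(1,3) by blast
    have "finite (E \<inter> S \<times> S)" using finS by simp
    moreover have "(y, x) \<notin> E \<inter> S \<times> S" using xy(3) by blast
    moreover have "(x, y) \<notin> insert (y, x) (E \<inter> S \<times> S)" using xy(3) \<open>x \<noteq> y\<close> by blast
    ultimately have "card (insert (x, y) (insert (y, x) (E \<inter> S \<times> S))) = card (E \<inter> S \<times> S) + 2"
      by simp
    then have "2 * Suc k \<le> card (insert (x, y) (insert (y, x) (E \<inter> S \<times> S)))"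
      using S(3) by simp
    also have "\<dots> \<le> card (E \<inter> insert y S \<times> insert y S)"
      using xy yx finS by (intro card_mono) auto
    finally show ?case
      using S xy finS by (intro exI[of _ "insert y S"]) auto
  qed
  have "card V > 0" using fin ne by (simp add: card_gt_0_iff)
  then obtain S where "S \<subseteq> V" "card S = card V" "2 * (card V - 1) \<le> card (E \<inter> S \<times> S)"
    using grow[of "card V - 1"] by auto
  then show ?thesis using card_subset_eq[OF fin] by auto
qed

text \<open>
  This passes from connectedness by walks to the cut condition that the growth argument uses.
\<close>

lemma (in sym_digraph) connected_edge_leaving:
  assumes "connected G" and "S \<subset> verts G" and "S \<noteq> {}"
  shows "\<exists>x\<in>S. \<exists>y\<in>verts G - S. (x, y) \<in> arcs_ends G"
proof (rule ccontr)
  assume no: "\<not> ?thesis"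
  obtain s u where su: "s \<in> S" "u \<in> verts G" "u \<notin> S" using assms(2,3) by auto
  have "s \<rightarrow>\<^sup>* u"
    using assms su reachable_mk_symmetric_eq[OF sym_arcs, of s u]
    by (auto simp: connected_def strongly_connected_def)
  then have "(s, u) \<in> (arcs_ends G)\<^sup>*" by (rule reachable_rtranclI)
  then have "u \<in> S"
  proof induction
    case base
    show ?case by (rule su(1))
  next
    case (step y z)
    then have "z \<in> verts G" by (auto dest: adj_in_verts)
    then show ?case using no step by blast
  qed
  with su show False by blast
qed

text \<open>
  A path from \<open>u\<close> to \<open>w\<close> that avoids \<open>v\<close> closes up with the edges \<open>vu\<close> and \<open>wv\<close> to a cycle. As
  \<open>u \<noteq> w\<close>, the path has an arc, so that the cycle is not one of the cycles of length two formed by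
  opposite arcs.
\<close>

lemma (in graph) neighbours_apart_if_acyclic:
  assumes acyclic: "\<not> (\<exists>c. cycle c \<and> 3 \<le> length c)"
    and vu: "(v, u) \<in> arcs_ends G" and vw: "(v, w) \<in> arcs_ends G" and "u \<noteq> w"
  shows "\<not> u \<rightarrow>\<^sup>*\<^bsub>del_vert v\<^esub> w"
proof
  assume reach: "u \<rightarrow>\<^sup>*\<^bsub>del_vert v\<^esub> w"
  interpret H: wf_digraph "del_vert v" by (rule wf_digraph_del_vert)
  obtain p where p: "H.apath u p w" using reach by (auto simp: H.reachable_apath)
  then have "p \<noteq> []" using \<open>u \<noteq> w\<close> by (auto simp: H.apath_Nil_iff)
  \<comment> \<open>Walks only refer to tails and heads of arcs, which deleting a vertex does not change.\<close>
  have verts_eq: "H.awalk_verts x q = awalk_verts x q" for x q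
    by (induction q arbitrary: x) (auto simp: H.awalk_verts.simps del_vert_simps)
  have cas_eq: "H.cas x q y = cas x q y" for x q y
    by (induction q arbitrary: x) (auto simp: H.cas.simps del_vert_simps)
  have walk: "awalk u p w" and dist: "distinct (awalk_verts u p)"
    and avoid: "v \<notin> set (awalk_verts u p)"
    using p H.awalk_verts_in_verts[of u p v]
    by (auto simp: H.apath_def H.awalk_def awalk_def verts_eq cas_eq del_vert_simps)
  obtain e where e: "e \<in> arcs G" "tail G e = v" "head G e = u"
    using vu by (auto simp: arcs_ends_conv)
  obtain f where f: "f \<in> arcs G" "tail G f = w" "head G f = v"
    using arcs_ends_symmetric[OF sym_arcs vw] by (auto simp: arcs_ends_conv)
  have step: "awalk w [f] v" using f by (auto simp: awalk_simps)
  have "awalk v (e # p @ [f]) v"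
    using e walk step by (auto simp: awalk_Cons_iff intro: awalk_appendI)
  moreover have "distinct (tl (awalk_verts v (e # p @ [f])))"
    using walk step f e dist avoid by (auto simp: awalk_verts_append[of u p "[f]" v] awalk_appendI)
  ultimately have "cycle (e # p @ [f])" by (auto simp: cycle_def)
  moreover have "3 \<le> length (e # p @ [f])" using \<open>p \<noteq> []\<close> by (cases p) auto
  ultimately show False using acyclic by blast
qed

abbreviation branches :: "('a, 'b) pre_digraph \<Rightarrow> 'a \<Rightarrow> 'a set set" where
  "branches T v \<equiv> pre_digraph.sccs_verts (pre_digraph.del_vert T v)"

text \<open>
  Sending a neighbour of \<open>v\<close> to its component in \<open>T - v\<close> is injective, so there are at least as many
  components as neighbours; summed over \<open>v\<close>, the neighbours count every arc once.
\<close>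

lemma tree_sum_branches_ge:
  assumes "is_tree T"
  shows "2 * (card (verts T) - 1) \<le> (\<Sum>v\<in>verts T. card (branches T v))"
proof -
  interpret graph T using assms by (simp add: is_tree_def)
  have conn: "Digraph_Component.connected T" using assms by (simp add: is_tree_def)
  have degree: "card (arcs_ends T `` {v}) \<le> card (branches T v)" if "v \<in> verts T" for v
  proof (rule card_inj_on_le)
    interpret H: fin_digraph "del_vert v" by (rule fin_digraph_del_vert)
    have nb: "u \<in> verts (del_vert v)" if "(v, u) \<in> arcs_ends T" for u
      using that by (auto simp: del_vert_simps dest: adj_in_verts adj_not_same)
    show "inj_on H.scc_of (arcs_ends T `` {v})"
    proof (rule inj_onI, rule ccontr)
      fix u w assume uw: "u \<in> arcs_ends T `` {v}" "w \<in> arcs_ends T `` {v}"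
        "H.scc_of u = H.scc_of w" "u \<noteq> w"
      then have "w \<in> H.scc_of u" using H.in_scc_of_self[OF nb, of w] by auto
      then have "u \<rightarrow>\<^sup>*\<^bsub>del_vert v\<^esub> w" by (simp add: H.scc_of_def)
      then show False using neighbours_apart_if_acyclic uw assms by (auto simp: is_tree_def)
    qed
    show "H.scc_of ` (arcs_ends T `` {v}) \<subseteq> branches T v"
      using nb by (auto intro: H.scc_of_in_sccs_verts)
    show "finite (branches T v)"
      by (simp add: H.sccs_verts_conv_scc_of)
  qed
  have sub: "arcs_ends T \<subseteq> verts T \<times> verts T" by (auto dest: adj_in_verts)
  have "2 * (card (verts T) - 1) \<le> card (arcs_ends T \<inter> verts T \<times> verts T)"
    using conn connected_edge_leaving[OF conn] sym_arcs
    by (intro double_spanning_edges_le_card)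
       (auto simp: connected_def strongly_connected_def symmetric_def)
  also have "arcs_ends T \<inter> verts T \<times> verts T = (SIGMA v:verts T. arcs_ends T `` {v})"
    using sub by auto
  also have "card \<dots> = (\<Sum>v\<in>verts T. card (arcs_ends T `` {v}))"
    using finite_subset[OF sub] by (intro card_SigmaI) (auto intro: finite_Image)
  also have "\<dots> \<le> (\<Sum>v\<in>verts T. card (branches T v))"
    by (intro sum_mono degree)
  finally show ?thesis .
qed

section \<open>Upper bounds for every strategy\<close>

lemma verts_surviving_tree_eq:
  "verts (surviving_tree T v p) = pre_digraph.scc_of (pre_digraph.del_vert T v) p"
  by (simp add: surviving_tree_def Let_def)

text \<open>
  \<open>X\<close> survives the next guess with probability \<open>1 - pmf (\<sigma> h C) p\<close>, and winning requires surviving.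
\<close>

lemma mover_survival_le:
  "pmf (play \<sigma> p True h C) True \<le> 1 - pmf (\<sigma> h C) p"
proof -
  let ?k = "\<lambda>v. if v = p \<or> v \<notin> verts C \<or> infinite (verts C) then return_pmf (\<not> True)
       else play \<sigma> p (\<not> True) ((C, v) # h) (surviving_tree C v p)"
  have "pmf (play \<sigma> p True h C) True = (\<integral>v. pmf (?k v) True \<partial>measure_pmf (\<sigma> h C))"
    by (simp only: play.simps[of \<sigma> p True h C] pmf_bind if_True)
  also have "\<dots> \<le> (\<integral>v. indicat_real (- {p}) v \<partial>measure_pmf (\<sigma> h C))"
    by (intro integral_mono measure_pmf.integrable_const_bound[where B = 1])
       (auto simp: pmf_le_1 indicator_def)
  also have "\<dots> = measure_pmf.prob (\<sigma> h C) (- {p})"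
    by simp
  also have "\<dots> = 1 - pmf (\<sigma> h C) p"
    using measure_pmf.prob_compl[of "{p}" "\<sigma> h C"] by (simp add: measure_pmf_single Compl_eq_Diff_UNIV)
  finally show ?thesis .
qed

text \<open>
  The strategy does not see \<open>p\<close>: the same distribution \<open>\<sigma> h C\<close> is used for every \<open>p\<close>, and its weights
  add up to \<open>1\<close>.
\<close>

lemma sum_mover_survival_le:
  assumes "\<sigma> \<in> strategies" and "finite (verts C)" and "verts C \<noteq> {}"
  shows "(\<Sum>p\<in>verts C. pmf (play \<sigma> p True h C) True) \<le> real (card (verts C)) - 1"
proof -
  have "(\<Sum>p\<in>verts C. pmf (play \<sigma> p True h C) True) \<le> (\<Sum>p\<in>verts C. 1 - pmf (\<sigma> h C) p)"
    by (intro sum_mono mover_survival_le)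
  also have "\<dots> = real (card (verts C)) - 1"
    using assms sum_pmf_eq_1[of "verts C" "\<sigma> h C"] by (simp add: sum_subtractf strategies_def)
  finally show ?thesis .
qed

text \<open>
  Positions of the poison in the same component of \<open>T - v\<close> leave \<open>X\<close> with the same tree, so the
  previous bound costs \<open>1\<close> for each component.
\<close>

lemma sum_after_deletion_le:
  assumes \<sigma>: "\<sigma> \<in> strategies" and "fin_digraph T" and v: "v \<in> verts T"
  shows "(\<Sum>p\<in>verts T - {v}. pmf (play \<sigma> p True h (surviving_tree T v p)) True)
    \<le> real (card (verts T)) - 1 - real (card (branches T v))"
proof -
  interpret fin_digraph T by fact
  interpret H: fin_digraph "del_vert v" by (rule fin_digraph_del_vert)
  define g where "g p = pmf (play \<sigma> p True h (surviving_tree T v p)) True" for p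
  have V: "verts (del_vert v) = verts T - {v}" by (simp add: del_vert_simps)
  have branches: "H.sccs_verts = H.scc_of ` (verts T - {v})"
    by (simp add: H.sccs_verts_conv_scc_of V)
  have fibre: "{x \<in> verts T - {v}. H.scc_of x = H.scc_of q} = H.scc_of q" if "q \<in> verts T - {v}" for q
    using that H.in_scc_of_self H.scc_of_eq unfolding V[symmetric]
    by (auto simp: H.scc_of_def H.reachable_in_verts)
  have branch: "(\<Sum>p\<in>C. g p) \<le> real (card C) - 1" if "C \<in> H.sccs_verts" for C
  proof -
    from that obtain q where q: "q \<in> verts T - {v}" "C = H.scc_of q" by (auto simp: branches)
    let ?U = "surviving_tree T v q"
    have C: "C = verts ?U" by (simp add: q verts_surviving_tree_eq)
    have "surviving_tree T v p = ?U" if "p \<in> C" for p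
      using that q(2) H.scc_of_eq[of p q] by (simp add: surviving_tree_def Let_def)
    then have "(\<Sum>p\<in>C. g p) = (\<Sum>p\<in>verts ?U. pmf (play \<sigma> p True h ?U) True)"
      unfolding C[symmetric] by (simp add: g_def)
    also have "\<dots> \<le> real (card (verts ?U)) - 1"
    proof (rule sum_mover_survival_le[OF \<sigma>])
      show "finite (verts ?U)"
        using verts_surviving_tree[of T v q] finite_verts by (meson finite_Diff finite_subset)
      show "verts ?U \<noteq> {}"
        using q H.in_scc_of_self[of q] by (auto simp: verts_surviving_tree_eq V)
    qed
    finally show ?thesis unfolding C .
  qed
  have group: "(\<Sum>p\<in>verts T - {v}. k p) = (\<Sum>C\<in>H.sccs_verts. \<Sum>p\<in>C. k p)" for k :: "_ \<Rightarrow> real"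
  proof -
    have "(\<Sum>p\<in>verts T - {v}. k p)
        = (\<Sum>C\<in>H.sccs_verts. \<Sum>p | p \<in> verts T - {v} \<and> H.scc_of p = C. k p)"
      unfolding branches by (rule sum.image_gen) simp
    also have "\<dots> = (\<Sum>C\<in>H.sccs_verts. \<Sum>p\<in>C. k p)"
      unfolding branches using fibre by (intro sum.cong refl) auto
    finally show ?thesis .
  qed
  have "(\<Sum>p\<in>verts T - {v}. g p) \<le> (\<Sum>C\<in>H.sccs_verts. real (card C) - 1)"
    unfolding group by (intro sum_mono branch)
  also have "\<dots> = (\<Sum>p\<in>verts T - {v}. 1) - real (card H.sccs_verts)"
    unfolding group by (simp add: sum_subtractf)
  also have "\<dots> = real (card (verts T)) - 1 - real (card H.sccs_verts)"
    using v card_gt_0_iff[of "verts T"] by (auto simp: card_Diff_singleton)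
  finally show ?thesis by (simp add: g_def)
qed

lemma prob_misere_game:
  assumes "finite (verts T)" and "verts T \<noteq> {}"
  shows "measure_pmf.prob (misere_game \<sigma> x T) {True}
    = (\<Sum>p\<in>verts T. pmf (play \<sigma> p x [] T) True) / real (card (verts T))"
  using assms by (simp add: measure_pmf_single misere_game_def pmf_bind_pmf_of_set)

lemma play_random_mover:
  assumes "finite (verts T)" and "verts T \<noteq> {}"
  shows "pmf (play \<sigma> p False h T) True
    = (\<Sum>v\<in>verts T. if v = p then 1
        else pmf (play \<sigma> p True ((T, v) # h) (surviving_tree T v p)) True) / real (card (verts T))"
proof -
  have step: "(\<Sum>v\<in>verts T. pmf (if v = p \<or> v \<notin> verts T \<or> infinite (verts T) then return_pmf (\<not> False)
        else play \<sigma> p (\<not> False) ((T, v) # h) (surviving_tree T v p)) True)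
      = (\<Sum>v\<in>verts T. if v = p then 1
        else pmf (play \<sigma> p True ((T, v) # h) (surviving_tree T v p)) True)"
    using assms by (intro sum.cong refl) auto
  show ?thesis
    by (simp only: play.simps[of \<sigma> p False h T] if_False pmf_bind_pmf_of_set[OF assms(2,1)] step)
qed

lemma prob_first_le:
  assumes "\<sigma> \<in> strategies" and "finite (verts T)" and "verts T \<noteq> {}"
  shows "measure_pmf.prob (misere_game \<sigma> True T) {True}
    \<le> (real (card (verts T)) - 1) / real (card (verts T))"
  unfolding prob_misere_game[OF assms(2,3)]
  by (intro divide_right_mono sum_mover_survival_le assms) simp

text \<open>
  Exchanging the sums over the poison \<open>p\<close> and the first guess \<open>v\<close> of \<open>R\<close> collects, for each \<open>v\<close>, the
  \<open>1\<close> from \<open>p = v\<close> and the positions of the poison that survive \<open>v\<close>.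
\<close>

lemma prob_second_eq:
  assumes "finite (verts T)" and "verts T \<noteq> {}"
  shows "measure_pmf.prob (misere_game \<sigma> False T) {True}
    = (\<Sum>v\<in>verts T. 1 + (\<Sum>p\<in>verts T - {v}. pmf (play \<sigma> p True [(T, v)] (surviving_tree T v p)) True))
      / (real (card (verts T)))\<^sup>2"
proof -
  define g where "g v p = pmf (play \<sigma> p True [(T, v)] (surviving_tree T v p)) True" for v p
  have "(\<Sum>p\<in>verts T. \<Sum>v\<in>verts T. if v = p then 1 else g v p)
      = (\<Sum>v\<in>verts T. \<Sum>p\<in>verts T. if v = p then 1 else g v p)"
    by (rule sum.swap)
  also have "\<dots> = (\<Sum>v\<in>verts T. 1 + (\<Sum>p\<in>verts T - {v}. g v p))"
    using assms by (intro sum.cong refl) (auto simp: sum.remove intro!: sum.cong)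
  finally show ?thesis
    unfolding prob_misere_game[OF assms] play_random_mover[OF assms] g_def
    by (simp add: power2_eq_square flip: sum_divide_distrib)
qed

lemma tree_prob_second_le:
  assumes "\<sigma> \<in> strategies" and tree: "is_tree T"
  defines "n \<equiv> real (card (verts T))"
  shows "measure_pmf.prob (misere_game \<sigma> False T) {True} \<le> (n + (n - 1) * (n - 2)) / n\<^sup>2"
proof -
  interpret graph T using tree by (simp add: is_tree_def)
  have ne: "verts T \<noteq> {}"
    using tree by (auto simp: is_tree_def connected_def strongly_connected_def)
  have "1 \<le> card (verts T)" using ne by (simp add: Suc_le_eq card_gt_0_iff)
  then have branches: "2 * (n - 1) \<le> (\<Sum>v\<in>verts T. real (card (branches T v)))"
    using of_nat_mono[OF tree_sum_branches_ge[OF tree], where ?'a = real]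
    by (simp add: n_def of_nat_diff)
  have "(\<Sum>v\<in>verts T. 1 + (\<Sum>p\<in>verts T - {v}. pmf (play \<sigma> p True [(T, v)] (surviving_tree T v p)) True))
      \<le> (\<Sum>v\<in>verts T. 1 + (n - 1 - real (card (branches T v))))"
    unfolding n_def
    by (intro sum_mono add_left_mono sum_after_deletion_le assms(1) fin_digraph_axioms)
  also have "\<dots> = n * n - (\<Sum>v\<in>verts T. real (card (branches T v)))"
    by (simp add: sum_subtractf sum.distrib n_def algebra_simps)
  also have "\<dots> \<le> n + (n - 1) * (n - 2)"
    using branches by (simp add: algebra_simps)
  finally show ?thesis
    unfolding prob_second_eq[OF finite_verts ne] n_def by (rule divide_right_mono) simp
qed

section \<open>Guessing the centre of a star\<close>

text \<open>
  Once the centre is gone every remaining component is a single vertex, so the default guess is then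
  forced.
\<close>

definition hub_first :: "(nat, 'b) strategy" where
  "hub_first h C = return_pmf (if 0 \<in> verts C then 0 else SOME v. v \<in> verts C)"

lemma hub_first_strategy: "hub_first \<in> strategies"
  by (auto simp: strategies_def hub_first_def some_in_eq)

text \<open>
  The statements are about any graph whose arcs all touch \<open>0\<close>, because \<open>hub_first\<close> is used both on the
  star and on the star without a leaf.
\<close>

lemma del_hub_isolates:
  fixes C :: "(nat, 'b) pre_digraph"
  assumes "p \<in> verts C" and "p \<noteq> 0" and hub: "\<And>a b. (a, b) \<in> arcs_ends C \<Longrightarrow> a = 0 \<or> b = 0"
  shows "verts (surviving_tree C 0 p) = {p}"
proof -
  let ?H = "pre_digraph.del_vert C 0"
  have no_arcs: "arcs_ends ?H = {}"
    using hub by (fastforce simp: arcs_ends_def arc_to_ends_def pre_digraph.del_vert_simps)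
  have "(a, b) \<in> rtrancl_on V {} \<longleftrightarrow> a = b \<and> a \<in> V" for a b :: nat and V
    by (auto elim: rtrancl_on.cases)
  then show ?thesis
    using assms(1,2)
    by (auto simp: verts_surviving_tree_eq pre_digraph.scc_of_def reachable_def no_arcs
        pre_digraph.del_vert_simps)
qed

lemma hub_first_wins:
  fixes C :: "(nat, 'b) pre_digraph"
  assumes "finite (verts C)" and "0 \<in> verts C" and "p \<in> verts C"
    and "\<And>a b. (a, b) \<in> arcs_ends C \<Longrightarrow> a = 0 \<or> b = 0"
  shows "play hub_first p True h C = return_pmf (p \<noteq> 0)"
proof (cases "p = 0")
  case True
  then show ?thesis using assms(2) by (subst play.simps) (simp add: hub_first_def bind_return_pmf)
next
  case False
  have single: "verts (surviving_tree C 0 p) = {p}"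
    using assms False by (intro del_hub_isolates)
  have "play hub_first p False h' (surviving_tree C 0 p) = return_pmf True" for h'
    by (subst play.simps) (simp add: single pmf_of_set_singleton bind_return_pmf)
  then show ?thesis
    using False assms by (subst play.simps) (simp add: hub_first_def bind_return_pmf)
qed

lemma verts_star: "verts (star n) = {0..<n}"
  by (simp add: star_def)

lemma arcs_ends_star: "arcs_ends (star n) = {0} \<times> {1..<n} \<union> {1..<n} \<times> {0}"
  by (auto simp: star_def arcs_ends_def arc_to_ends_def)

text \<open>
  The centre joins all the other vertices, so deleting a leaf leaves one component, in which
  \<open>hub_first\<close> can still guess the centre.
\<close>

lemma star_after_leaf:
  assumes "v \<in> {1..<n}" and "p \<in> {0..<n} - {v}"
  defines "C \<equiv> surviving_tree (star n) v p"
  shows "0 \<in> verts C" and "p \<in> verts C" and "\<And>a b. (a, b) \<in> arcs_ends C \<Longrightarrow> a = 0 \<or> b = 0"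
proof -
  let ?H = "pre_digraph.del_vert (star n) v"
  have V: "verts ?H = {0..<n} - {v}"
    by (simp add: pre_digraph.del_vert_simps verts_star)
  have E: "arcs_ends ?H = {(a, b) \<in> arcs_ends (star n). a \<noteq> v \<and> b \<noteq> v}"
    by (auto simp: arcs_ends_def arc_to_ends_def pre_digraph.del_vert_simps)
  have refl: "x \<rightarrow>\<^sup>*\<^bsub>?H\<^esub> x" if "x \<in> {0..<n} - {v}" for x
    using that by (auto simp: reachable_def V)
  have step: "x \<rightarrow>\<^sup>*\<^bsub>?H\<^esub> y" if "(x, y) \<in> arcs_ends ?H" "x \<in> {0..<n} - {v}" "y \<in> {0..<n} - {v}" for x y
    using rtrancl_on_into_rtrancl_on[OF rtrancl_on_refl[OF that(2)] that(1) that(3)]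
    unfolding reachable_def V .
  have "0 \<rightarrow>\<^sup>*\<^bsub>?H\<^esub> p \<and> p \<rightarrow>\<^sup>*\<^bsub>?H\<^esub> 0"
  proof (cases "p = 0")
    case True
    then show ?thesis using refl assms by auto
  next
    case False
    then have "(0, p) \<in> arcs_ends ?H" "(p, 0) \<in> arcs_ends ?H"
      using assms by (auto simp: E arcs_ends_star)
    then show ?thesis using assms by (auto intro: step)
  qed
  then show "0 \<in> verts C" "p \<in> verts C"
    using refl[of p] assms by (auto simp: C_def verts_surviving_tree_eq pre_digraph.scc_of_def)
  have "arcs_ends C \<subseteq> arcs_ends (star n)"
    by (auto simp: C_def surviving_tree_def Let_def arcs_ends_def arc_to_ends_def
        induce_subgraph_def pre_digraph.del_vert_simps)
  then show "\<And>a b. (a, b) \<in> arcs_ends C \<Longrightarrow> a = 0 \<or> b = 0"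
    by (auto simp: arcs_ends_star)
qed

lemma hub_first_star_first:
  assumes "n \<ge> 1"
  shows "measure_pmf.prob (misere_game hub_first True (star n)) {True} = (real n - 1) / real n"
proof -
  have "play hub_first p True [] (star n) = return_pmf (p \<noteq> 0)" if "p < n" for p
    using that assms by (intro hub_first_wins) (auto simp: verts_star arcs_ends_star)
  then have "(\<Sum>p\<in>{0..<n}. pmf (play hub_first p True [] (star n)) True)
      = (\<Sum>p\<in>{0..<n}. if p = 0 then 0 else 1)"
    by (intro sum.cong refl) auto
  also have "\<dots> = real n - 1"
    using assms by (simp add: sum.If_cases Collect_neg_eq Diff_eq[symmetric] of_nat_diff)
  finally show ?thesis using assms by (simp add: prob_misere_game verts_star)
qed

text \<open>
  If \<open>R\<close> first guesses the poison, \<open>X\<close> wins, which accounts for \<open>n\<close> of the \<open>n\<^sup>2\<close> pairs \<open>(v, p)\<close>. Each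
  of the \<open>n - 1\<close> leaves \<open>v\<close> adds the \<open>n - 2\<close> positions \<open>p\<close> other than \<open>v\<close> and the centre. When \<open>R\<close>
  guesses the centre and misses, \<open>X\<close> is left with the poison alone; these pairs are bounded below
  by \<open>0\<close>.
\<close>

lemma hub_first_star_second:
  assumes "n \<ge> 1"
  shows "(real n + (real n - 1) * (real n - 2)) / (real n)\<^sup>2
    \<le> measure_pmf.prob (misere_game hub_first False (star n)) {True}"
proof -
  define g where
    "g v p = pmf (play hub_first p True [(star n, v)] (surviving_tree (star n) v p)) True" for v p
  have leaf: "(\<Sum>p\<in>{0..<n} - {v}. g v p) = real n - 2" if v: "v \<in> {1..<n}" for v
  proof -
    have "g v p = (if p = 0 then 0 else 1)" if p: "p \<in> {0..<n} - {v}" for p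
    proof -
      have "finite (verts (surviving_tree (star n) v p))"
        using verts_surviving_tree[of "star n" v p]
        by (rule finite_subset) (simp add: verts_star)
      then show ?thesis
        using star_after_leaf[OF v p] by (simp add: g_def hub_first_wins)
    qed
    then have "(\<Sum>p\<in>{0..<n} - {v}. g v p) = (\<Sum>p\<in>{0..<n} - {v}. if p = 0 then 0 else 1)"
      by (rule sum.cong[OF refl])
    also have "\<dots> = (\<Sum>p\<in>{0..<n} - {v} - {0}. 1)"
      by (intro sum.mono_neutral_cong_right) auto
    also have "\<dots> = real n - 2"
      using v by (simp add: card_Diff_subset of_nat_diff)
    finally show ?thesis .
  qed
  have "real n + (real n - 1) * (real n - 2)
      = (\<Sum>v\<in>{0..<n}. 1) + (\<Sum>v\<in>{1..<n}. real n - 2)"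
    using assms by (simp add: of_nat_diff)
  also have "\<dots> = (\<Sum>v\<in>{0..<n}. 1) + (\<Sum>v\<in>{1..<n}. \<Sum>p\<in>{0..<n} - {v}. g v p)"
    using leaf by simp
  also have "\<dots> \<le> (\<Sum>v\<in>{0..<n}. 1) + (\<Sum>v\<in>{0..<n}. \<Sum>p\<in>{0..<n} - {v}. g v p)"
    by (intro add_left_mono sum_mono2) (auto simp: g_def intro: sum_nonneg)
  also have "\<dots> = (\<Sum>v\<in>{0..<n}. 1 + (\<Sum>p\<in>{0..<n} - {v}. g v p))"
    by (simp only: sum.distrib)
  finally show ?thesis
    using assms by (simp add: prob_second_eq verts_star g_def divide_right_mono)
qed

lemma prob_le_SUP_strategies:
  assumes "\<sigma> \<in> strategies"
  shows "measure_pmf.prob (misere_game \<sigma> x T) {True}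
    \<le> (SUP \<sigma>\<in>strategies. measure_pmf.prob (misere_game \<sigma> x T) {True})"
  using assms by (intro cSUP_upper) (auto intro!: bdd_aboveI2[where M = 1])

lemma strategies_nonempty: "(strategies :: ('a, 'b) strategy set) \<noteq> {}"
proof -
  have "(\<lambda>h T. return_pmf (SOME v. v \<in> verts T)) \<in> (strategies :: ('a, 'b) strategy set)"
    by (auto simp: strategies_def some_in_eq)
  then show ?thesis by blast
qed

section \<open>Comparison with the star\<close>

theorem theorem1p3:
  fixes T :: "('a, 'b) pre_digraph" and n :: nat
  assumes "is_tree T" and "card (verts T) = n"
  shows "misere_P T \<le> misere_P (star n) \<and> misere_Q T \<le> misere_Q (star n)"
proof -
  interpret graph T using assms by (simp add: is_tree_def)
  have ne: "verts T \<noteq> {}"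
    using assms by (auto simp: is_tree_def connected_def strongly_connected_def)
  then have n: "n \<ge> 1" using assms(2) by (auto simp: Suc_le_eq card_gt_0_iff)
  have "misere_P T \<le> (real n - 1) / real n"
    unfolding misere_P_def using prob_first_le[OF _ finite_verts ne] assms(2)
    by (intro cSUP_least strategies_nonempty) simp
  also have "\<dots> \<le> misere_P (star n)"
    using prob_le_SUP_strategies[OF hub_first_strategy, of True "star n"] hub_first_star_first[OF n]
    by (simp add: misere_P_def)
  finally have P: "misere_P T \<le> misere_P (star n)" .
  have "misere_Q T \<le> (real n + (real n - 1) * (real n - 2)) / (real n)\<^sup>2"
    unfolding misere_Q_def using tree_prob_second_le[OF _ assms(1)] assms(2)
    by (intro cSUP_least strategies_nonempty) simp
  also have "\<dots> \<le> misere_Q (star n)"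
    using prob_le_SUP_strategies[OF hub_first_strategy, of False "star n"] hub_first_star_second[OF n]
    by (simp add: misere_Q_def)
  finally have Q: "misere_Q T \<le> misere_Q (star n)" .
  from P Q show ?thesis by blast
qed

end
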